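(* Let $a\le b$ be natural numbers with $b\ge1$. Then there exists a family of simple connected graphs $\{G_n\}$, indexed by odd $n$, such that $\lim_{n\to\infty,\ n\text{ odd}}\mathrm{rate}(\mathcal{C}(\mathcal{P}_{G_n}))=a/b$.
   Context: For a simple connected graph $G$ on $[m]$ with Laplacian matrix $L$ ($L_{ii}=\deg(i)$, $L_{ij}=-1$ if $\{i,j\}$ is an edge, $0$ otherwise) and $L(m)$ being $L$ with its $m$-th column deleted, the associated linear code is $\mathcal{C}(\mathcal{P}_G)=\{\bar{\mathbf{x}}\in\mathbb{Z}_m^m\mid\bar{\mathbf{x}}[L(m)\mid\mathbb{1}]=\mathbf{0}\text{ in }\mathbb{Z}_m^m\}$, where $[L(m)\mid\mathbb{1}]$ is $L(m)$ with a column of ones appended. The rate of a code $\mathcal{C}\subseteq\mathbb{Z}_q^N$ is $\log_q(|\mathcal{C}|)/N$. *)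

theory Defs
  imports
    Complex_Main
    "HOL-Number_Theory.Cong"
    "Graph_Theory.Pair_Digraph"
    "Graph_Theory.Digraph_Component"
    "Jordan_Normal_Form.Matrix"
begin

text \<open>An undirected edge \<open>{u, v}\<close> is represented by the two arcs \<open>(u, v)\<close> and \<open>(v, u)\<close>:
  \<^locale>\<open>pair_graph\<close> says that the arc set is symmetric and loop-free and the graph is finite.\<close>

definition simple_connected_graph_on :: "nat \<Rightarrow> nat pair_pre_digraph \<Rightarrow> bool" where
  "simple_connected_graph_on m G \<longleftrightarrow>
     pair_graph G \<and> pverts G = {1..m} \<and> Digraph_Component.connected (with_proj G)"

text \<open>Matrices are indexed from 0 while vertices are numbered from 1, so index \<open>i\<close> stands
  for the vertex \<open>i + 1\<close>.  The degree of a vertex is the number of arcs leaving it.\<close>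

definition laplacian :: "nat \<Rightarrow> nat pair_pre_digraph \<Rightarrow> int mat" where
  "laplacian m G = mat m m (\<lambda>(i, j).
     if i = j then int (out_degree (with_proj G) (i + 1))
     else if (i + 1, j + 1) \<in> parcs G then -1
     else 0)"

definition delete_last_col :: "'a mat \<Rightarrow> 'a mat" where
  "delete_last_col A = mat (dim_row A) (dim_col A - 1) (\<lambda>(i, j). A $$ (i, j))"

definition append_ones_col :: "'a :: one mat \<Rightarrow> 'a mat" where
  "append_ones_col A = mat (dim_row A) (dim_col A + 1)
     (\<lambda>(i, j). if j < dim_col A then A $$ (i, j) else 1)"

text \<open>The words over \<open>\<int>/m\<close> of length \<open>m\<close> are represented by the integer vectors with entries
  in \<open>{0, \<dots>, m - 1}\<close>.  The \<open>j\<close>-th entry of the row vector \<open>x A\<close> is \<open>x \<bullet> col A j\<close>.\<close>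

definition code :: "nat \<Rightarrow> nat pair_pre_digraph \<Rightarrow> int vec set" where
  "code m G =
    (let A = append_ones_col (delete_last_col (laplacian m G)) in
     {x \<in> carrier_vec m. (\<forall>i<m. x $ i \<in> {0..<int m}) \<and>
        (\<forall>j<dim_col A. [x \<bullet> col A j = 0] (mod int m))})"

text \<open>The rate of a code of length \<open>N\<close> over \<open>\<int>/q\<close>; only meaningful for \<open>q \<ge> 2\<close>
  (\<^term>\<open>log 1 x\<close> is the junk value 0).\<close>

definition rate :: "nat \<Rightarrow> nat \<Rightarrow> 'a set \<Rightarrow> real" where
  "rate q N C = log (real q) (real (card C)) / real N"

end

theory Submission
  imports Defs "HOL-Real_Asymp.Real_Asymp"
begin

text \<open>Let \<open>G\<close> be the complete graph \<open>K\<^sub>m\<close> with the edges of a star removed, so that \<open>k \<ge> 1\<close>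
  vertices stay dominating.  Since \<open>L = m I - J - L'\<close> with \<open>L'\<close> the Laplacian of the star, modulo
  \<open>m\<close> the code consists of the words \<open>x\<close> with entry sum \<open>0\<close> and \<open>x L' = 0\<close>, and the latter says
  that \<open>x\<close> is constant on the star.  Hence the code has exactly \<open>m ^ k\<close> elements and its rate
  is \<open>k / m\<close>; it remains to let \<open>k / m\<close> tend to \<open>a / b\<close>.\<close>

section \<open>The graph and its connectedness\<close>

text \<open>The removed star has centre \<open>m\<close> and leaves \<open>k + 1, \<dots>, m - 1\<close>.  The column deleted from the
  Laplacian is then that of the centre, and every other column contributes at most one equation
  between a leaf and the centre.\<close>

definition complete_minus_star :: "nat \<Rightarrow> nat \<Rightarrow> nat pair_pre_digraph" where
  "complete_minus_star m k = \<lparr>pverts = {1..m},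
     parcs = {(u, v). u \<in> {1..m} \<and> v \<in> {1..m} \<and> u \<noteq> v \<and>
                \<not> (v = m \<and> k < u) \<and> \<not> (u = m \<and> k < v)}\<rparr>"

lemma pair_graph_complete_minus_star: "pair_graph (complete_minus_star m k)"
proof
  show "finite (parcs (complete_minus_star m k))"
    by (rule finite_subset[of _ "{1..m} \<times> {1..m}"]) (auto simp: complete_minus_star_def)
qed (auto simp: complete_minus_star_def symmetric_def sym_def)

text \<open>Vertex \<open>1\<close> is neither a leaf nor the centre of the removed star, hence
  adjacent to every other vertex; any two vertices are joined through it.\<close>

lemma simple_connected_complete_minus_star:
  assumes "1 \<le> k" "k < m"
  shows "simple_connected_graph_on m (complete_minus_star m k)"
proof -
  define G where "G = complete_minus_star m k"
  interpret pair_graph G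
    unfolding G_def by (rule pair_graph_complete_minus_star)
  have verts: "pverts G = {1..m}"
    by (simp add: G_def complete_minus_star_def)
  have reach_to: "u \<rightarrow>\<^sup>*\<^bsub>with_proj G\<^esub> 1" and reach_from: "1 \<rightarrow>\<^sup>*\<^bsub>with_proj G\<^esub> u" if "u \<in> {1..m}" for u
  proof -
    have "u = 1 \<or> (u, 1) \<in> parcs G \<and> (1, u) \<in> parcs G"
      using that assms by (auto simp: G_def complete_minus_star_def)
    then have "u \<rightarrow>\<^sup>*\<^bsub>with_proj G\<^esub> 1 \<and> 1 \<rightarrow>\<^sup>*\<^bsub>with_proj G\<^esub> u"
      using that verts by (metis reachable_refl reachable_adjI)
    then show "u \<rightarrow>\<^sup>*\<^bsub>with_proj G\<^esub> 1" "1 \<rightarrow>\<^sup>*\<^bsub>with_proj G\<^esub> u" by auto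
  qed
  have "u \<rightarrow>\<^sup>*\<^bsub>mk_symmetric (with_proj G)\<^esub> v" if "u \<in> {1..m}" "v \<in> {1..m}" for u v
    using reachable_trans[OF reach_to reach_from] that by (intro reachable_mk_symmetricI) auto
  then have "Digraph_Component.connected (with_proj G)"
    using assms verts by (auto simp: connected_def strongly_connected_def)
  then show ?thesis
    using pair_graph_complete_minus_star verts by (simp add: simple_connected_graph_on_def G_def)
qed

section \<open>Degrees and columns of the Laplacian\<close>

lemma out_degree_with_proj:
  "out_degree (with_proj G) u = card {v. (u, v) \<in> parcs G}"
proof -
  have "out_arcs (with_proj G) u = Pair u ` {v. (u, v) \<in> parcs G}"
    by (auto simp: out_arcs_def)
  then show ?thesis
    by (simp add: out_degree_def card_image inj_on_def)
qed

text \<open>A vertex other than the centre can lose only its edge to the centre, and exactly the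
  leaves \<open>u > k\<close> do. The degree of the centre occurs only in the deleted
  column.\<close>

lemma out_degree_complete_minus_star:
  assumes "1 \<le> u" "u < m"
  shows "out_degree (with_proj (complete_minus_star m k)) u = (if u \<le> k then m - 1 else m - 2)"
proof -
  have "{v. (u, v) \<in> parcs (complete_minus_star m k)} =
      (if u \<le> k then {1..m} - {u} else {1..m} - {u, m})"
    using assms by (auto simp: complete_minus_star_def)
  moreover have "card ({1..m} - {u, m}) = m - 2"
    using assms by (subst card_Diff_subset) auto
  ultimately show ?thesis
    using assms by (simp add: out_degree_with_proj)
qed

text \<open>This pairs \<open>x\<close> with one column of \<open>m I - J - L'\<close>. Index
  \<open>j\<close> is vertex \<open>j + 1\<close>, so \<open>k \<le> j\<close> marks a leaf, and
  index \<open>m - 1\<close> is the centre.\<close>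

lemma scalar_prod_laplacian_complete_minus_star:
  assumes x: "x \<in> carrier_vec m" and j: "Suc j < m"
  shows "x \<bullet> col (laplacian m (complete_minus_star m k)) j =
    int m * x $ j - (\<Sum>i<m. x $ i) + (if k \<le> j then x $ (m - 1) - x $ j else 0)"
proof -
  let ?L = "laplacian m (complete_minus_star m k)"
  \<comment> \<open>The diagonal term and the term in the row of the centre each leave a single
    summand; the constant \<open>-1\<close> yields the entry sum.\<close>
  have entry: "?L $$ (i, j) = (if i = j then int m - of_bool (k \<le> j) else 0) - 1
      + (if i = m - 1 then of_bool (k \<le> j) else 0)" if "i < m" for i
    using that j out_degree_complete_minus_star[of "j + 1" m k]
    by (auto simp: laplacian_def complete_minus_star_def of_nat_diff)
  have "x \<bullet> col ?L j = (\<Sum>i<m. x $ i * ?L $$ (i, j))"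
    using j by (auto simp: scalar_prod_def laplacian_def lessThan_atLeast0 intro!: sum.cong)
  also have "\<dots> = (\<Sum>i<m. (if i = j then x $ i * (int m - of_bool (k \<le> j)) else 0) - x $ i
      + (if i = m - 1 then x $ i * of_bool (k \<le> j) else 0))"
    by (intro sum.cong) (simp_all add: entry ring_distribs)
  also have "\<dots> = x $ j * (int m - of_bool (k \<le> j)) - (\<Sum>i<m. x $ i)
      + x $ (m - 1) * of_bool (k \<le> j)"
    using j by (simp add: sum.distrib sum_subtractf)
  finally show ?thesis
    by (auto simp: algebra_simps)
qed

section \<open>The code and its cardinality\<close>

text \<open>The appended column of ones takes index \<open>m - 1\<close>, exactly the place of the
  deleted column.\<close>

lemma code_alt_def:
  assumes "m \<ge> 1"
  shows "code m G = {x \<in> carrier_vec m. (\<forall>i<m. x $ i \<in> {0..<int m}) \<and>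
    (\<forall>j. Suc j < m \<longrightarrow> [x \<bullet> col (laplacian m G) j = 0] (mod int m)) \<and>
    [(\<Sum>i<m. x $ i) = 0] (mod int m)}"
proof -
  let ?A = "append_ones_col (delete_last_col (laplacian m G))"
  have dim: "dim_row (laplacian m G) = m" "dim_col (laplacian m G) = m"
    by (simp_all add: laplacian_def)
  have dimA: "dim_col ?A = m"
    using assms by (simp add: append_ones_col_def delete_last_col_def dim)
  have lap: "col ?A j = col (laplacian m G) j" if "Suc j < m" for j
    using that by (intro eq_vecI) (auto simp: append_ones_col_def delete_last_col_def dim)
  have ones: "x \<bullet> col ?A (m - 1) = (\<Sum>i<m. x $ i)" for x
    using assms by (auto simp: append_ones_col_def delete_last_col_def dim scalar_prod_def
        lessThan_atLeast0 intro!: sum.cong)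
  have split: "(\<forall>j<m. P j) \<longleftrightarrow> (\<forall>j. Suc j < m \<longrightarrow> P j) \<and> P (m - 1)" for P
    using assms by (cases m) (auto simp: All_less_Suc)
  show ?thesis
    unfolding code_def Let_def dimA split by (auto simp: lap ones[unfolded One_nat_def])
qed

lemma cong_atLeastLessThan_iff:
  fixes x y m :: int
  assumes "x \<in> {0..<m}" "y \<in> {0..<m}"
  shows "[x = y] (mod m) \<longleftrightarrow> x = y"
  using assms by (simp add: Cong.cong_def)

text \<open>Once the entry sum vanishes modulo \<open>m\<close>, column \<open>j\<close> leaves only
  the star term of the scalar product. As entries are reduced residues, its vanishing modulo
  \<open>m\<close> at a leaf is an equality.\<close>

lemma code_complete_minus_star:
  assumes "1 \<le> k" "k < m"
  shows "code m (complete_minus_star m k) = {x \<in> carrier_vec m.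
    (\<forall>i<m. x $ i \<in> {0..<int m}) \<and> (\<forall>j\<in>{k..<m}. x $ j = x $ (m - 1)) \<and>
    [(\<Sum>i<m. x $ i) = 0] (mod int m)}"
proof -
  have "(\<forall>j. Suc j < m \<longrightarrow> [x \<bullet> col (laplacian m (complete_minus_star m k)) j = 0] (mod int m))
      \<longleftrightarrow> (\<forall>j\<in>{k..<m}. x $ j = x $ (m - 1))"
    if x: "x \<in> carrier_vec m" and range: "\<forall>i<m. x $ i \<in> {0..<int m}"
      and sum: "[(\<Sum>i<m. x $ i) = 0] (mod int m)" for x
  proof -
    have "[x \<bullet> col (laplacian m (complete_minus_star m k)) j = 0] (mod int m) \<longleftrightarrow>
        (k \<le> j \<longrightarrow> x $ j = x $ (m - 1))" if j: "Suc j < m" for j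
    proof -
      define d where "d = (if k \<le> j then x $ (m - 1) - x $ j else 0)"
      have "int m dvd int m * x $ j - (\<Sum>i<m. x $ i)"
        using sum by (simp add: cong_0_iff)
      then have "[x \<bullet> col (laplacian m (complete_minus_star m k)) j = 0] (mod int m) \<longleftrightarrow> int m dvd d"
        unfolding scalar_prod_laplacian_complete_minus_star[OF x j] d_def cong_0_iff
        by (simp add: dvd_add_right_iff)
      also have "\<dots> \<longleftrightarrow> (k \<le> j \<longrightarrow> [x $ (m - 1) = x $ j] (mod int m))"
        by (simp add: d_def cong_iff_dvd_diff)
      also have "\<dots> \<longleftrightarrow> (k \<le> j \<longrightarrow> x $ j = x $ (m - 1))"
        using range j by (subst cong_atLeastLessThan_iff) auto
      finally show ?thesis .
    qed
    then have "(\<forall>j. Suc j < m \<longrightarrow> [x \<bullet> col (laplacian m (complete_minus_star m k)) j = 0] (mod int m))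
        \<longleftrightarrow> (\<forall>j. Suc j < m \<longrightarrow> k \<le> j \<longrightarrow> x $ j = x $ (m - 1))"
      by blast
    \<comment> \<open>The index \<open>m - 1\<close> of the centre has no Laplacian equation, but
      there the claim is trivial.\<close>
    also have "\<dots> \<longleftrightarrow> (\<forall>j\<in>{k..<m}. x $ j = x $ (m - 1))"
    proof (intro iffI allI ballI impI)
      fix j assume "\<forall>j. Suc j < m \<longrightarrow> k \<le> j \<longrightarrow> x $ j = x $ (m - 1)" and j: "j \<in> {k..<m}"
      then have "Suc j < m \<Longrightarrow> x $ j = x $ (m - 1)"
        by (meson atLeastLessThan_iff)
      moreover have "Suc j < m \<or> j = m - 1"
        using j by auto
      ultimately show "x $ j = x $ (m - 1)"
        by blast
    next
      fix j assume "\<forall>j\<in>{k..<m}. x $ j = x $ (m - 1)" "Suc j < m" "k \<le> j"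
      then show "x $ j = x $ (m - 1)"
        by (meson Suc_lessD atLeastLessThan_iff)
    qed
    finally show ?thesis .
  qed
  moreover have "m \<ge> 1"
    using assms by simp
  ultimately show ?thesis
    unfolding code_alt_def[OF \<open>m \<ge> 1\<close>] by (intro Collect_cong) blast
qed

text \<open>The coordinates \<open>1, \<dots>, k\<close> (counted from \<open>0\<close>) are free: coordinate \<open>k\<close> carries the common
  value on the star, and coordinate \<open>0\<close> is determined by the vanishing of the sum.\<close>

lemma card_code_complete_minus_star:
  assumes "1 \<le> k" "k < m"
  shows "card (code m (complete_minus_star m k)) = m ^ k"
proof -
  let ?C = "code m (complete_minus_star m k)"
  let ?F = "{1..k} \<rightarrow>\<^sub>E {0..<int m}"
  define res where "res x = restrict (\<lambda>i. x $ i) {1..k}" for x :: "int vec"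
  \<comment> \<open>Capping the index at \<open>k\<close> copies the common value along the star;
    for \<open>i \<ge> 1\<close> the argument of \<open>f\<close> stays in
    \<open>{1..k}\<close>.\<close>
  define tail where "tail f i = (f (min i k) :: int)" for f i
  define ext where
    "ext f = vec m (\<lambda>i. if i = 0 then (- (\<Sum>i\<in>{1..<m}. tail f i)) mod int m else tail f i)" for f
  have sum_split: "(\<Sum>i<m. g i) = g 0 + (\<Sum>i\<in>{1..<m}. g i)" for g :: "nat \<Rightarrow> int"
    using assms by (simp add: lessThan_atLeast0 sum.atLeast_Suc_lessThan)
  have in_code: "x \<in> ?C \<longleftrightarrow> x \<in> carrier_vec m \<and> (\<forall>i<m. x $ i \<in> {0..<int m}) \<and>
      (\<forall>j\<in>{k..<m}. x $ j = x $ (m - 1)) \<and> [(\<Sum>i<m. x $ i) = 0] (mod int m)" for x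
    unfolding code_complete_minus_star[OF assms] by blast
  have tail_res: "tail (res x) i = x $ i" if "x \<in> ?C" "i \<in> {1..<m}" for x i
  proof (cases "i \<le> k")
    case False
    then have "i \<in> {k..<m}" "k \<in> {k..<m}"
      using that assms by auto
    then have "x $ i = x $ k"
      using that(1) unfolding in_code by metis
    then show ?thesis
      using False assms by (simp add: tail_def res_def)
  qed (use that in \<open>auto simp: tail_def res_def\<close>)
  have "bij_betw res ?C ?F"
  proof (rule bij_betw_byWitness[where f' = ext])
    show "\<forall>x\<in>?C. ext (res x) = x"
    proof
      fix x assume x: "x \<in> ?C"
      have x0: "x $ 0 \<in> {0..<int m}"
        using x order.strict_trans1[OF le0 assms(2)] unfolding in_code by blast
      have dim: "dim_vec x = m"
        using x unfolding in_code carrier_vec_def by blast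
      have "[x $ 0 + (\<Sum>i\<in>{1..<m}. x $ i) = 0] (mod int m)"
        using x unfolding in_code sum_split by blast
      then have "[- (\<Sum>i\<in>{1..<m}. x $ i) = x $ 0] (mod int m)"
        by (subst cong_iff_dvd_diff, subst dvd_minus_iff[symmetric]) (simp add: cong_0_iff)
      then have "(- (\<Sum>i\<in>{1..<m}. x $ i)) mod int m = x $ 0"
        using x0 by (simp add: Cong.cong_def)
      then show "ext (res x) = x"
        using tail_res[OF x] dim by (intro eq_vecI) (auto simp: ext_def)
    qed
    show "\<forall>f\<in>?F. res (ext f) = f"
    proof
      fix f assume "f \<in> ?F"
      \<comment> \<open>Inside \<open>{1..k}\<close> the cap has no effect; outside, both functions
        are \<open>undefined\<close>, as \<open>f\<close> is extensional.\<close>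
      then show "res (ext f) = f"
        using assms by (auto simp: fun_eq_iff res_def ext_def tail_def PiE_def extensional_def)
    qed
    show "res ` ?C \<subseteq> ?F"
    proof
      fix f assume "f \<in> res ` ?C"
      then obtain x where f: "f = res x" and "x \<in> ?C"
        by blast
      then have "\<forall>i<m. x $ i \<in> {0..<int m}"
        unfolding in_code by blast
      then show "f \<in> ?F"
        using assms by (auto simp: f res_def)
    qed
    show "ext ` ?F \<subseteq> ?C"
    proof
      fix x assume "x \<in> ext ` ?F"
      then obtain f where f: "f \<in> ?F" and x: "x = ext f" by blast
      have "tail f i \<in> {0..<int m}" if "i \<ge> 1" for i
        using f that assms by (auto simp: tail_def intro: PiE_mem)
      then have "\<forall>i<m. x $ i \<in> {0..<int m}"
        using assms by (auto simp: x ext_def)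
      moreover have "\<forall>j\<in>{k..<m}. x $ j = x $ (m - 1)"
        using assms by (auto simp: x ext_def tail_def)
      moreover have "[(\<Sum>i<m. x $ i) = 0] (mod int m)"
      proof -
        have "(\<Sum>i<m. x $ i) = (- (\<Sum>i\<in>{1..<m}. tail f i)) mod int m + (\<Sum>i\<in>{1..<m}. tail f i)"
          using assms by (simp add: sum_split x ext_def)
        then show ?thesis
          by (simp add: Cong.cong_def mod_add_left_eq)
      qed
      ultimately show "x \<in> ?C"
        unfolding in_code by (simp add: x ext_def)
    qed
  qed
  then have "card ?C = card ?F"
    by (rule bij_betw_same_card)
  then show ?thesis
    by (simp add: card_PiE)
qed

section \<open>Rate and limit\<close>

text \<open>The assumptions force \<open>m \<ge> 2\<close>, so the logarithm has a genuine base and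
  sends \<open>m ^ k\<close> to \<open>k\<close>.\<close>

lemma rate_complete_minus_star:
  assumes "1 \<le> k" "k < m"
  shows "rate m m (code m (complete_minus_star m k)) = real k / real m"
  using assms by (simp add: rate_def card_code_complete_minus_star log_nat_power)

theorem theorem4p12:
  fixes a b :: nat
  assumes "a \<le> b" and "b \<ge> 1"
  shows "\<exists>(m :: nat \<Rightarrow> nat) (G :: nat \<Rightarrow> nat pair_pre_digraph).
           (\<forall>n. odd n \<longrightarrow> m n \<ge> 2 \<and> simple_connected_graph_on (m n) (G n)) \<and>
           ((\<lambda>n. rate (m n) (m n) (code (m n) (G n))) \<longlongrightarrow> real a / real b)
             (inf sequentially (principal {n. odd n}))"
proof -
  \<comment> \<open>The offsets \<open>2\<close> and \<open>1\<close> secure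
    \<open>1 \<le> k n\<close> even if \<open>a = 0\<close>, and \<open>k n < m n\<close> even if
    \<open>a = b\<close>; they vanish in the limit of the quotient.\<close>
  define m where "m n = b * n + 2" for n
  define k where "k n = a * n + 1" for n
  have k: "1 \<le> k n" "k n < m n" for n
    using mult_le_mono1[OF assms(1), of n]
    by (auto simp: k_def m_def less_Suc_eq_le simp del: mult_le_cancel2)
  have "(\<lambda>n. real (k n) / real (m n)) \<longlonglongrightarrow> real a / real b"
  proof -
    have "real b > 0" using assms(2) by simp
    then have "(\<lambda>n. (real a * real n + 1) / (real b * real n + 2)) \<longlonglongrightarrow> real a / real b"
      by real_asymp (simp add: divide_inverse)
    then show ?thesis by (simp add: k_def m_def add_ac)
  qed
  \<comment> \<open>A limit along \<open>sequentially\<close> passes to the finer filter of odd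
    indices.\<close>
  then have "((\<lambda>n. rate (m n) (m n) (code (m n) (complete_minus_star (m n) (k n))))
      \<longlongrightarrow> real a / real b) (inf sequentially (principal {n. odd n}))"
    unfolding rate_complete_minus_star[OF k] by (rule tendsto_mono[OF inf_le1])
  moreover have "m n \<ge> 2" for n
    by (simp add: m_def)
  ultimately show ?thesis
    using simple_connected_complete_minus_star[OF k]
    by (intro exI[of _ m] exI[of _ "\<lambda>n. complete_minus_star (m n) (k n)"] conjI allI impI)
qed

end
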